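(* For all $\delta \geqslant 0$, $$- \frac{1}{m} \log \mathbb{P}(d_{m,m} \geqslant m^2 \delta) \xrightarrow[m\to \infty]{} J(\delta) := \begin{cases} \left(\frac{1}{2}-\delta\right) \lambda(\delta) +\log\left(1-\left(\frac{1}{2}+\delta\right) \lambda(\delta)\right) & \text{if } \delta<1/2,\\ \infty & \text{if } \delta\geqslant 1/2, \end{cases}$$ where, for $\delta \in [0,1/2)$, $\lambda(\delta)$ is the smallest real solution $\lambda$ of the equation $$\left(\lambda \left(\delta+\frac 12\right)-1\right)(1-e^\lambda) = \lambda .$$
   Context: Hashing with linear probing (parking on a circle): for integers $1\leqslant m$ and $0 \leqslant n \leqslant m$, there are $m$ parking spaces numbered $1,\dots,m$ and arranged cyclically ($m$ is followed by $1$). $n$ cars arrive sequentially; their addresses are independent and uniformly distributed on $\{1,\dots,m\}$. A car with address $h$ parks at the first unoccupied space in the cyclic order $h, h+1,\dots,m,1,2,\dots,h-1$. The displacement of a car is the number of spaces it moves from its address to the space where it parks (it is $0$ if its address is unoccupied). The total displacement $d_{m,n}$ is the sum of the displacements of the $n$ cars. The case $n=m$ is that of full tables. Convention: $\log 0 = -\infty$. (For $\delta = 0$, $\lambda(0)=0$ is the unique solution of the equation; for $\delta\in(0,1/2)$ the equation has two solutions, $\lambda(\delta)<0$ and $0$.) *)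

theory Defs
  imports "HOL-Probability.Probability"
begin

text \<open>The space reached from \<open>h\<close> after \<open>k\<close> steps, for \<open>m\<close> spaces \<open>{1..m}\<close> arranged
  cyclically and \<open>h \<in> {1..m}\<close>.\<close>

definition space_after :: "nat \<Rightarrow> nat \<Rightarrow> nat \<Rightarrow> nat" where
  "space_after m h k = (h - 1 + k) mod m + 1"

text \<open>\<open>S\<close> is the set of occupied spaces. The minimum exists as long as some space is free, which
  is the case whenever a car arrives in a sequence of at most \<open>m\<close> cars.\<close>

definition displacement :: "nat \<Rightarrow> nat set \<Rightarrow> nat \<Rightarrow> nat" where
  "displacement m S h = (LEAST k. space_after m h k \<notin> S)"

definition parking_space :: "nat \<Rightarrow> nat set \<Rightarrow> nat \<Rightarrow> nat" where
  "parking_space m S h = space_after m h (displacement m S h)"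

fun total_displacement_from :: "nat \<Rightarrow> nat set \<Rightarrow> nat list \<Rightarrow> nat" where
  "total_displacement_from m S [] = 0"
| "total_displacement_from m S (h # hs) =
     displacement m S h + total_displacement_from m (insert (parking_space m S h) S) hs"

definition total_displacement :: "nat \<Rightarrow> nat list \<Rightarrow> nat" where
  "total_displacement m hs = total_displacement_from m {} hs"

text \<open>The law of the list of addresses, in order of arrival, of \<open>n\<close> cars.\<close>

definition addresses :: "nat \<Rightarrow> nat \<Rightarrow> nat list pmf" where
  "addresses m n = replicate_pmf n (pmf_of_set {1..m})"

text \<open>The law of $d_{m,n}$.\<close>

definition total_displacement_pmf :: "nat \<Rightarrow> nat \<Rightarrow> nat pmf" where
  "total_displacement_pmf m n = map_pmf (total_displacement m) (addresses m n)"

text \<open>The logarithm with $\log 0 = -\infty$, applied here to probabilities only.\<close>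

definition elog :: "real \<Rightarrow> ereal" where
  "elog x = (if x \<le> 0 then -\<infinity> else ereal (ln x))"

definition lam :: "real \<Rightarrow> real" where
  "lam \<delta> = (LEAST l :: real. (l * (\<delta> + 1/2) - 1) * (1 - exp l) = l)"

definition J :: "real \<Rightarrow> ereal" where
  "J \<delta> = (if \<delta> < 1/2
            then ereal ((1/2 - \<delta>) * lam \<delta> + ln (1 - (1/2 + \<delta>) * lam \<delta>))
            else \<infinity>)"

end

theory Submission
  imports Defs "HOL-Real_Asymp.Real_Asymp"
begin

text \<open>
  Parking turns out to be a sum of independent variables in disguise. Cut the circle after a space
  \<open>v\<close> and let \<open>r\<^sub>v(x) \<in> {0..<m}\<close> be the number of steps from the space following \<open>v\<close> to \<open>x\<close>. A car that
  drives from \<open>h\<close> to \<open>p\<close> without crossing the cut is displaced by \<open>r\<^sub>v(p) - r\<^sub>v(h)\<close>, and by more if it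
  crosses the cut. Since \<open>m\<close> cars fill all the spaces, adding up gives
  \<open>d \<ge> \<Sum>{..<m} - \<Sum>\<^sub>h r\<^sub>v(h)\<close> for every \<open>v\<close>. Equality holds when no car crosses the cut, and this
  happens for the space \<open>v\<close> taken by the last car: it was free all the time, so nobody drove past
  it. Hence \<open>d\<close> is the maximum over \<open>v\<close> of \<open>\<Sum>{..<m} - \<Sum>\<^sub>h r\<^sub>v(h)\<close>. For each \<open>v\<close> the numbers
  \<open>r\<^sub>v(h)\<close> are independent and uniform on \<open>{0..<m}\<close>, so with \<open>T = \<Sum>{..<m} - (U\<^sub>1 + \<dots> + U\<^sub>m)\<close> for
  such \<open>U\<^sub>i\<close>, the union bound gives
  \<open>P(T \<ge> x) \<le> P(d \<ge> x) \<le> m P(T \<ge> x)\<close> (\<open>prob_total_displacement_sandwich\<close>). The factor \<open>m\<close> is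
  invisible on the exponential scale.

  What remains is a theorem of Cramer type for \<open>T / m\<close>. A geometric sum shows that
  \<open>1/m log E exp (t T / m)\<close> tends to \<open>\<Lambda>(t) = log E exp (t (1/2 - U))\<close> with \<open>U\<close> uniform on \<open>[0,1]\<close>
  (\<open>mgf_deficit_rate\<close>). Convergence of these scaled logarithms to a differentiable limit whose
  derivative is strictly increasing already determines upper tail probabilities
  (\<open>upper_tail_rate\<close>): the rate at level \<open>\<delta>\<close> is \<open>t \<delta> - \<Lambda>(t)\<close> where \<open>\<Lambda>'(t) = \<delta>\<close>. Here
  \<open>\<Lambda>'\<close> increases from \<open>0\<close> to \<open>1/2\<close> on the positive half-line, and \<open>\<Lambda>'(t) = \<delta>\<close> is the equation
  defining \<open>\<lambda>(\<delta>)\<close> after the substitution \<open>\<lambda> = -t\<close>, which turns the rate into \<open>J\<close>.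
  Outside \<open>0 < \<delta> < 1/2\<close> nothing asymptotic happens: the event is certain for \<open>\<delta> = 0\<close>, where
  \<open>\<lambda>(0) = 0\<close>, and empty for \<open>\<delta> \<ge> 1/2\<close>, since \<open>T < m\<^sup>2 / 2\<close> always.
\<close>

section \<open>Parking on a circle cut open\<close>

text \<open>The coordinate \<open>r\<^sub>v\<close> on the circle cut after \<open>v\<close>: the space following \<open>v\<close> has coordinate \<open>0\<close> and
  \<open>v\<close> itself has coordinate \<open>m - 1\<close>. The summands are arranged so that no subtraction is truncated
  for \<open>x \<ge> 1\<close> and \<open>v \<le> m\<close>.\<close>

definition steps_past :: "nat \<Rightarrow> nat \<Rightarrow> nat \<Rightarrow> nat" where
  "steps_past m v x = (x - 1 + (m - v)) mod m"

lemma steps_past_bij: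
  assumes "v \<in> {1..m}"
  shows "bij_betw (steps_past m v) {1..m} {..<m}"
proof -
  have "k \<in> steps_past m v ` {1..m}" if "k < m" for k
  proof
    have "steps_past m v ((k + v) mod m + 1) = (k + (v + (m - v))) mod m"
      unfolding steps_past_def add_diff_cancel_right' mod_add_left_eq by (simp only: add.assoc)
    then show "k = steps_past m v ((k + v) mod m + 1)"
      using assms that by simp
    show "(k + v) mod m + 1 \<in> {1..m}"
      using that by (simp add: Suc_leI)
  qed
  then have surj: "steps_past m v ` {1..m} = {..<m}"
    using assms by (auto simp: steps_past_def)
  then have "inj_on (steps_past m v) {1..m}"
    by (intro eq_card_imp_inj_on) auto
  with surj show ?thesis
    by (simp add: bij_betw_def)
qed

lemma sum_steps_past:
  assumes "v \<in> {1..m}"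
  shows "(\<Sum>x\<in>{1..m}. steps_past m v x) = \<Sum>{..<m}"
  using sum.reindex_bij_betw[OF steps_past_bij[OF assms], of "\<lambda>x. x"] by simp

lemma space_after_in: "1 \<le> m \<Longrightarrow> space_after m h k \<in> {1..m}"
  by (simp add: space_after_def Suc_leI)

lemma steps_past_space_after:
  "steps_past m v (space_after m h k) = (steps_past m v h + k) mod m"
  by (simp add: steps_past_def space_after_def mod_simps add_ac)

text \<open>A driving car stops at \<open>v\<close> at the latest if \<open>v\<close> is free, so its coordinate never wraps around.\<close>

lemma displacement_stops_at_free:
  assumes v: "v \<in> {1..m}" "v \<notin> S"
  shows "steps_past m v h + displacement m S h < m" "parking_space m S h \<notin> S"
proof -
  have m: "1 \<le> m" using v by simp
  have less: "steps_past m v h < m"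
    using m by (simp add: steps_past_def)
  \<comment> \<open>the number of steps from \<open>h\<close> to \<open>v\<close>\<close>
  define k where "k = m - 1 - steps_past m v h"
  have "steps_past m v (space_after m h k) = m - 1"
    using less by (simp add: steps_past_space_after k_def)
  also have "m - 1 = steps_past m v v"
    using v by (simp add: steps_past_def)
  finally have "space_after m h k = v"
    using steps_past_bij[OF v(1)] space_after_in[OF m] v(1)
    by (meson bij_betw_imp_inj_on inj_onD)
  then have free: "space_after m h k \<notin> S" using v by simp
  then have "displacement m S h \<le> k"
    unfolding displacement_def by (rule Least_le)
  then show "steps_past m v h + displacement m S h < m"
    using less k_def by linarith
  show "parking_space m S h \<notin> S"
    unfolding parking_space_def displacement_def using free by (rule LeastI)
qed

text \<open>A car that crosses the cut loses \<open>m\<close> in its coordinate, hence only an inequality without a free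
  space at the cut.\<close>

lemma steps_past_parking_space_le:
  "steps_past m v (parking_space m S h) \<le> steps_past m v h + displacement m S h"
  by (simp add: parking_space_def steps_past_space_after)

lemma steps_past_parking_space:
  assumes "v \<in> {1..m}" "v \<notin> S"
  shows "steps_past m v (parking_space m S h) = steps_past m v h + displacement m S h"
  using displacement_stops_at_free(1)[OF assms] by (simp add: parking_space_def steps_past_space_after)

text \<open>Every car adds the coordinate of its space to the sum over occupied spaces, which in the end runs
  over the whole circle.\<close>

lemma total_displacement_from_ge:
  assumes "v \<in> {1..m}" "S \<subseteq> {1..m}" "card S + length hs = m"
  shows "(\<Sum>x\<in>{1..m}. steps_past m v x) \<le>
    total_displacement_from m S hs + (\<Sum>h\<leftarrow>hs. steps_past m v h) + (\<Sum>x\<in>S. steps_past m v x)"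
  using assms(2,3)
proof (induction hs arbitrary: S)
  case Nil
  then have "S = {1..m}"
    by (intro card_subset_eq) auto
  then show ?case by simp
next
  case (Cons h hs)
  let ?p = "parking_space m S h"
  have fin: "finite S" using Cons.prems finite_subset by blast
  have "card S \<noteq> card {1..m}" using Cons.prems by simp
  then have "S \<noteq> {1..m}" by blast
  then obtain w where "w \<in> {1..m}" "w \<notin> S" using Cons.prems by blast
  then have p: "?p \<notin> S" using displacement_stops_at_free by blast
  have "?p \<in> {1..m}"
    using assms(1) by (auto simp: parking_space_def space_after_def Suc_leI)
  then have "(\<Sum>x\<in>{1..m}. steps_past m v x) \<le>
      total_displacement_from m (insert ?p S) hs + (\<Sum>h\<leftarrow>hs. steps_past m v h)
      + (\<Sum>x\<in>insert ?p S. steps_past m v x)"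
    using Cons.prems p fin by (intro Cons.IH) auto
  also have "(\<Sum>x\<in>insert ?p S. steps_past m v x)
      = steps_past m v ?p + (\<Sum>x\<in>S. steps_past m v x)"
    using p fin by simp
  finally show ?case
    using steps_past_parking_space_le[of m v S h] by simp
qed

text \<open>The witness \<open>v\<close> is the space that the last car takes. It is free when each car arrives, so no car
  crosses the cut there and the inequalities of \<open>total_displacement_from_ge\<close> become equalities.\<close>

lemma total_displacement_from_eq:
  assumes "hs \<noteq> []" "S \<subseteq> {1..m}" "card S + length hs = m"
  shows "\<exists>v\<in>{1..m} - S. (\<Sum>x\<in>{1..m}. steps_past m v x) =
    total_displacement_from m S hs + (\<Sum>h\<leftarrow>hs. steps_past m v h) + (\<Sum>x\<in>S. steps_past m v x)"
  using assms
proof (induction hs arbitrary: S rule: list_nonempty_induct)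
  case (single h)
  have "card S \<noteq> card {1..m}" using single.prems by simp
  then have "S \<noteq> {1..m}" by blast
  then obtain v where v: "v \<in> {1..m}" "v \<notin> S" using single.prems by blast
  have fin: "finite S" using single.prems finite_subset by blast
  have "insert (parking_space m S h) S = {1..m}"
    using single.prems v fin displacement_stops_at_free(2)[OF v, of h]
    by (intro card_subset_eq)
      (auto simp: parking_space_def space_after_def Suc_leI)
  then have "(\<Sum>x\<in>{1..m}. steps_past m v x)
      = steps_past m v (parking_space m S h) + (\<Sum>x\<in>S. steps_past m v x)"
    using displacement_stops_at_free(2)[OF v, of h] fin by (metis sum.insert)
  then show ?case
    using v steps_past_parking_space[OF v, of h] by (intro bexI[of _ v]) auto
next
  case (cons h hs)
  let ?p = "parking_space m S h"
  have fin: "finite S" using cons.prems finite_subset by blast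
  have "card S \<noteq> card {1..m}" using cons.prems by simp
  then have "S \<noteq> {1..m}" by blast
  then obtain w where "w \<in> {1..m}" "w \<notin> S" using cons.prems by blast
  then have p: "?p \<notin> S" and m: "1 \<le> m" using displacement_stops_at_free by (blast, auto)
  have "?p \<in> {1..m}" using m by (auto simp only: parking_space_def intro!: space_after_in)
  then have "\<exists>v\<in>{1..m} - insert ?p S. (\<Sum>x\<in>{1..m}. steps_past m v x) =
      total_displacement_from m (insert ?p S) hs + (\<Sum>h\<leftarrow>hs. steps_past m v h)
      + (\<Sum>x\<in>insert ?p S. steps_past m v x)"
    using cons.prems p fin by (intro cons.IH) auto
  then obtain v where v: "v \<in> {1..m}" "v \<notin> S" and
    eq: "(\<Sum>x\<in>{1..m}. steps_past m v x) =
      total_displacement_from m (insert ?p S) hs + (\<Sum>h\<leftarrow>hs. steps_past m v h)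
      + (\<Sum>x\<in>insert ?p S. steps_past m v x)"
    by blast
  have "(\<Sum>x\<in>insert ?p S. steps_past m v x)
      = steps_past m v ?p + (\<Sum>x\<in>S. steps_past m v x)"
    using p fin by simp
  then show ?case
    using v eq steps_past_parking_space[OF v, of h] by (intro bexI[of _ v]) auto
qed

text \<open>By how much the sum of the coordinates \<open>ks\<close> of the addresses falls short of the sum of the
  coordinates of all spaces.\<close>

definition deficit :: "nat \<Rightarrow> nat list \<Rightarrow> real" where
  "deficit m ks = real (\<Sum>{..<m}) - real (sum_list ks)"

lemma deficit_le_total_displacement:
  assumes "v \<in> {1..m}" "length hs = m"
  shows "deficit m (map (steps_past m v) hs) \<le> total_displacement m hs"
  using total_displacement_from_ge[OF assms(1), of "{}" hs] assms(2)
  unfolding deficit_def total_displacement_def sum_steps_past[OF assms(1)]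
  by (simp del: of_nat_sum)

lemma total_displacement_eq_deficit:
  assumes "1 \<le> m" "length hs = m"
  shows "\<exists>v\<in>{1..m}. total_displacement m hs = deficit m (map (steps_past m v) hs)"
proof -
  obtain v where v: "v \<in> {1..m}" and
    "(\<Sum>x\<in>{1..m}. steps_past m v x) =
      total_displacement_from m {} hs + (\<Sum>h\<leftarrow>hs. steps_past m v h)"
    using total_displacement_from_eq[of hs "{}" m] assms by force
  then show ?thesis
    unfolding deficit_def total_displacement_def sum_steps_past[OF v]
    by (intro bexI[OF _ v]) (simp del: of_nat_sum)
qed

section \<open>Reduction to independent uniform variables\<close>

lemma map_pmf_replicate_pmf:
  "map_pmf (map f) (replicate_pmf n p) = replicate_pmf n (map_pmf f p)"
proof (induction n)
  case (Suc n)
  have "map_pmf (map f) (replicate_pmf (Suc n) p)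
      = p \<bind> (\<lambda>x. map_pmf (map f) (replicate_pmf n p) \<bind> (\<lambda>ys. return_pmf (f x # ys)))"
    by (simp add: map_bind_pmf bind_map_pmf)
  then show ?case
    by (simp add: Suc bind_map_pmf)
qed simp

lemma steps_past_addresses:
  assumes "v \<in> {1..m}"
  shows "map_pmf (map (steps_past m v)) (addresses m n) = replicate_pmf n (pmf_of_set {..<m})"
proof -
  have "map_pmf (steps_past m v) (pmf_of_set {1..m}) = pmf_of_set {..<m}"
    using assms by (intro map_pmf_of_set_bij_betw steps_past_bij) auto
  then show ?thesis by (simp add: addresses_def map_pmf_replicate_pmf)
qed

lemma length_addresses:
  assumes "hs \<in> set_pmf (addresses m n)"
  shows "length hs = n"
  using assms by (simp add: addresses_def set_replicate_pmf)

text \<open>The lower bound uses a single cut; the upper bound is the union bound over the \<open>m\<close> cuts, for each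
  of which the deficit has the same law by rotation invariance.\<close>

lemma prob_total_displacement_sandwich:
  fixes x :: real
  assumes m: "1 \<le> m"
  defines "T \<equiv> measure_pmf.prob (replicate_pmf m (pmf_of_set {..<m})) {ks. x \<le> deficit m ks}"
  defines "D \<equiv> measure_pmf.prob (total_displacement_pmf m m) {d. x \<le> real d}"
  shows "T \<le> D" "D \<le> real m * T"
proof -
  let ?E = "\<lambda>v. {hs. x \<le> deficit m (map (steps_past m v) hs)}"
  have T: "measure_pmf.prob (addresses m m) (?E v) = T" if "v \<in> {1..m}" for v
    unfolding T_def by (subst steps_past_addresses[OF that, symmetric]) (simp add: vimage_def)
  have D: "D = measure_pmf.prob (addresses m m) {hs. x \<le> real (total_displacement m hs)}"
    unfolding D_def total_displacement_pmf_def by (simp add: vimage_def)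
  have "measure_pmf.prob (addresses m m) (?E m) \<le> D"
    unfolding D using m deficit_le_total_displacement[of m m]
    by (intro measure_pmf.finite_measure_mono_AE)
      (auto simp: AE_measure_pmf_iff dest!: length_addresses intro: order_trans)
  then show "T \<le> D" using T m by simp
  have "D \<le> measure_pmf.prob (addresses m m) (\<Union>v\<in>{1..m}. ?E v)"
    unfolding D using total_displacement_eq_deficit[OF m]
    by (intro measure_pmf.finite_measure_mono_AE)
      (fastforce simp: AE_measure_pmf_iff dest!: length_addresses)+
  also have "\<dots> \<le> (\<Sum>v\<in>{1..m}. measure_pmf.prob (addresses m m) (?E v))"
    by (intro measure_pmf.finite_measure_subadditive_finite) auto
  also have "\<dots> = real m * T" using T by simp
  finally show "D \<le> real m * T" .
qed

section \<open>Upper tails from moment generating functions\<close>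

text \<open>A quantity with strictly smaller exponential rate is eventually a small fraction of another. The
  fraction \<open>1/4\<close> lets two such terms take up at most half of the whole.\<close>

lemma eventually_exp_le_quarter:
  fixes u v :: "nat \<Rightarrow> real"
  assumes "(\<lambda>m. u m / real m) \<longlonglongrightarrow> a" "(\<lambda>m. v m / real m) \<longlonglongrightarrow> b" "a < b"
  shows "\<forall>\<^sub>F m in sequentially. exp (u m) \<le> exp (v m) / 4"
proof -
  define c where "c = (b - a) / 2"
  have "(\<lambda>m. v m / real m - u m / real m) \<longlonglongrightarrow> b - a"
    using assms(1,2) by (intro tendsto_diff)
  moreover have "c < b - a" "0 < c" using assms(3) by (auto simp: c_def)
  ultimately have "\<forall>\<^sub>F m in sequentially. c < v m / real m - u m / real m"
    by (simp add: order_tendsto_iff)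
  moreover have "\<forall>\<^sub>F m in sequentially. ln 4 / c \<le> real m"
    using filterlim_real_sequentially by (simp add: filterlim_at_top)
  moreover have "\<forall>\<^sub>F m in sequentially. 0 < m"
    by (rule eventually_gt_at_top)
  ultimately show ?thesis
  proof eventually_elim
    case (elim m)
    have "ln 4 \<le> c * real m"
      using elim \<open>0 < c\<close> by (simp add: field_simps)
    also have "\<dots> \<le> v m - u m"
      using elim by (simp add: field_simps)
    finally have "exp (u m) \<le> exp (v m - ln 4)" by simp
    then show ?case by (simp add: exp_diff)
  qed
qed

text \<open>A one-sided theorem of Gaertner-Ellis type. The upper bound is Chernoff's inequality at \<open>t\<close>. For the
  lower bound, take \<open>s\<close> slightly larger than \<open>t\<close> and \<open>b\<close> slightly larger than \<open>L s\<close>. The expectation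
  \<open>Z s m\<close> is carried by the event \<open>L t * m \<le> Y \<le> b * m\<close>: on the two complementary events, lowering or
  raising the parameter \<open>s\<close> a little gives bounds of strictly smaller exponential rate, because
  the derivative \<open>L s\<close> of \<open>\<Lambda>\<close> lies strictly between \<open>L t\<close> and \<open>b\<close>. On the event itself the integrand
  is at most \<open>exp (s * b * m)\<close>, so its probability is at least about \<open>exp (- s * b * m) * Z s m\<close>.
  Finally let \<open>b\<close> tend to \<open>L s\<close> and \<open>s\<close> to \<open>t\<close>.\<close>

lemma upper_tail_rate:
  fixes p :: "nat \<Rightarrow> 'a pmf" and Y :: "nat \<Rightarrow> 'a \<Rightarrow> real" and \<Lambda> L :: "real \<Rightarrow> real"
  defines "Z \<equiv> \<lambda>\<theta> m. measure_pmf.expectation (p m) (\<lambda>x. exp (\<theta> * Y m x))"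
  defines "P \<equiv> \<lambda>a m. measure_pmf.prob (p m) {x. a * real m \<le> Y m x}"
  assumes integrable: "\<And>\<theta> m. 0 < \<theta> \<Longrightarrow> integrable (p m) (\<lambda>x. exp (\<theta> * Y m x))"
    and rate: "\<And>\<theta>. 0 < \<theta> \<Longrightarrow> (\<lambda>m. ln (Z \<theta> m) / real m) \<longlonglongrightarrow> \<Lambda> \<theta>"
    and deriv: "\<And>\<theta>. 0 < \<theta> \<Longrightarrow> (\<Lambda> has_real_derivative L \<theta>) (at \<theta>)"
    and mono: "strict_mono_on {0<..} L" and cont: "isCont L t" and t: "0 < t"
  shows "\<forall>\<^sub>F m in sequentially. 0 < P (L t) m"
    and "(\<lambda>m. ln (P (L t) m) / real m) \<longlonglongrightarrow> \<Lambda> t - t * L t"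
proof -
  have Z_pos: "0 < Z \<theta> m" if "0 < \<theta>" for \<theta> m
  proof -
    have "Z \<theta> m \<noteq> 0"
      unfolding Z_def using integral_nonneg_eq_0_iff_AE[OF integrable[OF that, of m]]
      by (simp add: AE_measure_pmf_iff set_pmf_not_empty)
    moreover have "0 \<le> Z \<theta> m" unfolding Z_def by simp
    ultimately show ?thesis by simp
  qed
  have lower: "\<forall>\<^sub>F m in sequentially. exp (- s * b * real m) * Z s m / 2 \<le> P (L t) m"
    if s: "t < s" "L s < b" for s b
  proof -
    have s0: "0 < s" using s t by simp
    have "L t < L s" using mono s t by (auto simp: strict_mono_on_def)
    have "((\<lambda>\<theta>. \<Lambda> \<theta> - L t * \<theta>) has_real_derivative L s - L t) (at s)"
      by (auto intro!: derivative_eq_intros deriv s0)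
    \<comment> \<open>the function increases at \<open>s\<close>, so a step \<open>h\<close> to the left loses rate; this controls \<open>Y < L t * m\<close>\<close>
    from DERIV_pos_inc_left[OF this] \<open>L t < L s\<close> obtain d where
      d: "0 < d" "\<And>h. 0 < h \<Longrightarrow> h < d \<Longrightarrow> \<Lambda> (s - h) - L t * (s - h) < \<Lambda> s - L t * s" by auto
    have "((\<lambda>\<theta>. \<Lambda> \<theta> - b * \<theta>) has_real_derivative L s - b) (at s)"
      by (auto intro!: derivative_eq_intros deriv s0)
    \<comment> \<open>the function decreases at \<open>s\<close>, so a step \<open>h\<close> to the right loses rate; this controls \<open>Y > b * m\<close>\<close>
    from DERIV_neg_dec_right[OF this] \<open>L s < b\<close> obtain e where
      e: "0 < e" "\<And>h. 0 < h \<Longrightarrow> h < e \<Longrightarrow> \<Lambda> (s + h) - b * (s + h) < \<Lambda> s - b * s" by auto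
    define h where "h = min s (min d e) / 2"
    have h: "0 < h" "h < s" "h < d" "h < e"
      using s0 d(1) e(1) by (auto simp: h_def min_def)
    have ev: "\<forall>\<^sub>F m in sequentially. exp (c * real m) * Z \<theta> m \<le> Z s m / 4"
      if "0 < \<theta>" "\<Lambda> \<theta> + c < \<Lambda> s" for \<theta> c
    proof -
      have "(\<lambda>m. ln (Z \<theta> m) / real m + c) \<longlonglongrightarrow> \<Lambda> \<theta> + c"
        using rate[OF that(1)] by (intro tendsto_intros)
      moreover have "\<forall>\<^sub>F m in sequentially. ln (Z \<theta> m) / real m + c = (ln (Z \<theta> m) + c * real m) / real m"
        using eventually_gt_at_top[of 0] by eventually_elim (simp add: field_simps)
      ultimately have "(\<lambda>m. (ln (Z \<theta> m) + c * real m) / real m) \<longlonglongrightarrow> \<Lambda> \<theta> + c"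
        by (rule Lim_transform_eventually)
      from eventually_exp_le_quarter[OF this rate[OF s0] that(2)] show ?thesis
        using Z_pos[OF that(1)] Z_pos[OF s0] by (simp add: exp_add mult.commute)
    qed
    have "\<forall>\<^sub>F m in sequentially. exp (h * L t * real m) * Z (s - h) m \<le> Z s m / 4"
      using h d(2)[of h] by (intro ev) (auto simp: algebra_simps)
    moreover have "\<forall>\<^sub>F m in sequentially. exp (- h * b * real m) * Z (s + h) m \<le> Z s m / 4"
      using h s0 e(2)[of h] by (intro ev) (auto simp: algebra_simps)
    ultimately show ?thesis
    proof eventually_elim
      case (elim m)
      \<comment> \<open>one summand for each of the events \<open>Y < L t * m\<close>, \<open>Y > b * m\<close> and the rest\<close>
      define f where "f x = exp (h * L t * real m) * exp ((s - h) * Y m x)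
          + exp (- h * b * real m) * exp ((s + h) * Y m x)
          + exp (s * b * real m) * indicator {x. L t * real m \<le> Y m x} x" for x
      have "exp (s * Y m x) \<le> f x" for x
      proof -
        consider "Y m x < L t * real m" | "b * real m < Y m x"
          | "L t * real m \<le> Y m x" "Y m x \<le> b * real m" by linarith
        then show ?thesis
        proof cases
          case 1
          have "h * Y m x \<le> h * (L t * real m)" using 1 h by (intro mult_left_mono) auto
          then have "exp (s * Y m x) \<le> exp (h * L t * real m) * exp ((s - h) * Y m x)"
            by (simp add: algebra_simps flip: exp_add)
          then show ?thesis using 1 by (simp add: f_def add_increasing2)
        next
          case 2
          have "h * (b * real m) \<le> h * Y m x" using 2 h by (intro mult_left_mono) auto
          then have "exp (s * Y m x) \<le> exp (- h * b * real m) * exp ((s + h) * Y m x)"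
            by (simp add: algebra_simps flip: exp_add)
          then show ?thesis
            unfolding f_def by (intro add_increasing2[OF _ add_increasing]) auto
        next
          case 3
          have "s * Y m x \<le> s * (b * real m)" using 3 s0 by (intro mult_left_mono) auto
          then have "exp (s * Y m x) \<le> exp (s * b * real m)"
            by (simp add: algebra_simps)
          then show ?thesis using 3 by (auto simp: f_def intro: add_increasing)
        qed
      qed
      moreover have int: "integrable (p m) (\<lambda>x. exp ((s - h) * Y m x))"
        "integrable (p m) (\<lambda>x. exp ((s + h) * Y m x))"
        "integrable (p m) (indicator {x. L t * real m \<le> Y m x} :: 'a \<Rightarrow> real)"
        using h s0 by (auto intro!: integrable integrable_real_indicator simp: less_top[symmetric])
      moreover have "integrable (p m) f"
        unfolding f_def using int by (intro Bochner_Integration.integrable_add integrable_mult_right)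
      ultimately have "Z s m \<le> measure_pmf.expectation (p m) f"
        unfolding Z_def by (intro integral_mono integrable s0)
      also have "\<dots> = exp (h * L t * real m) * Z (s - h) m + exp (- h * b * real m) * Z (s + h) m
          + exp (s * b * real m) * P (L t) m"
        unfolding f_def Z_def P_def using int by simp
      finally have "Z s m / 2 \<le> exp (s * b * real m) * P (L t) m"
        using elim by simp
      then have "exp (- s * b * real m) * (Z s m / 2)
          \<le> exp (- s * b * real m) * (exp (s * b * real m) * P (L t) m)"
        by (intro mult_left_mono) auto
      also have "\<dots> = P (L t) m" by (simp add: mult.assoc[symmetric] flip: exp_add)
      finally show ?case by simp
    qed
  qed
  \<comment> \<open>any admissible \<open>s\<close> and \<open>b\<close> show that the probability is positive\<close>
  have "\<forall>\<^sub>F m in sequentially. exp (- (t + 1) * (L (t + 1) + 1) * real m) * Z (t + 1) m / 2 \<le> P (L t) m"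
    using lower[of "t + 1" "L (t + 1) + 1"] by simp
  then show P_pos: "\<forall>\<^sub>F m in sequentially. 0 < P (L t) m"
  proof eventually_elim
    case (elim m)
    have "0 < exp (- (t + 1) * (L (t + 1) + 1) * real m) * Z (t + 1) m / 2"
      using Z_pos[of "t + 1" m] t by simp
    then show ?case using elim by linarith
  qed
  have chernoff: "P (L t) m \<le> exp (- t * L t * real m) * Z t m" for m
  proof -
    have "indicator {x. L t * real m \<le> Y m x} x \<le> exp (- t * L t * real m) * exp (t * Y m x)" for x
      using t by (auto simp: indicator_def mult.assoc simp flip: exp_add)
    then have "measure_pmf.expectation (p m) (indicator {x. L t * real m \<le> Y m x})
        \<le> measure_pmf.expectation (p m) (\<lambda>x. exp (- t * L t * real m) * exp (t * Y m x))"
      using t by (intro integral_mono integrable_real_indicator integrable_mult_right integrable)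
        (auto simp: less_top[symmetric])
    then show ?thesis by (simp add: P_def Z_def)
  qed
  show "(\<lambda>m. ln (P (L t) m) / real m) \<longlonglongrightarrow> \<Lambda> t - t * L t"
  proof (rule order_tendstoI)
    fix a assume "\<Lambda> t - t * L t < a"
    moreover have "(\<lambda>m. ln (Z t m) / real m - t * L t) \<longlonglongrightarrow> \<Lambda> t - t * L t"
      using rate[OF t] by (intro tendsto_intros)
    ultimately have "\<forall>\<^sub>F m in sequentially. ln (Z t m) / real m - t * L t < a"
      by (simp add: order_tendsto_iff)
    then show "\<forall>\<^sub>F m in sequentially. ln (P (L t) m) / real m < a"
      using P_pos eventually_gt_at_top[of 0]
    proof eventually_elim
      case (elim m)
      have "ln (P (L t) m) \<le> ln (exp (- t * L t * real m) * Z t m)"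
        using chernoff[of m] elim by simp
      also have "\<dots> = - t * L t * real m + ln (Z t m)"
        using Z_pos[OF t, of m] by (simp add: ln_mult)
      finally have "ln (P (L t) m) / real m \<le> ln (Z t m) / real m - t * L t"
        using elim by (simp add: field_simps)
      then show ?case using elim by linarith
    qed
  next
    fix a assume a: "a < \<Lambda> t - t * L t"
    have "isCont \<Lambda> t" using deriv[OF t] by (rule DERIV_isCont)
    with cont have "((\<lambda>s. \<Lambda> s - s * L s) \<longlongrightarrow> \<Lambda> t - t * L t) (at t)"
      by (intro tendsto_intros) (auto simp: isCont_def)
    then have "((\<lambda>s. \<Lambda> s - s * L s) \<longlongrightarrow> \<Lambda> t - t * L t) (at_right t)"
      by (simp add: filterlim_at_split)
    then have "\<forall>\<^sub>F s in at_right t. a < \<Lambda> s - s * L s"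
      using a by (simp add: order_tendsto_iff)
    then have "\<exists>s>t. a < \<Lambda> s - s * L s"
      by (auto simp: eventually_at_right_field dest: dense)
    then obtain s where s: "t < s" "a < \<Lambda> s - s * L s" by blast
    have s0: "0 < s" using s t by simp
    \<comment> \<open>close enough to \<open>L s\<close> to give away only half of the margin \<open>\<Lambda> s - s * L s - a\<close>\<close>
    define b where "b = L s + (\<Lambda> s - s * L s - a) / (2 * s)"
    have b: "L s < b" using s s0 by (simp add: b_def)
    have "\<Lambda> s - s * b = a + (\<Lambda> s - s * L s - a) / 2"
      using s0 by (simp add: b_def field_simps)
    then have "a < \<Lambda> s - s * b" using s(2) by simp
    moreover have "(\<lambda>m. ln (Z s m) / real m - s * b - ln 2 / real m) \<longlonglongrightarrow> \<Lambda> s - s * b - 0"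
      by (intro tendsto_intros rate[OF s0])
    ultimately have "\<forall>\<^sub>F m in sequentially. a < ln (Z s m) / real m - s * b - ln 2 / real m"
      by (simp add: order_tendsto_iff)
    then show "\<forall>\<^sub>F m in sequentially. a < ln (P (L t) m) / real m"
      using lower[OF s(1) b] eventually_gt_at_top[of 0]
    proof eventually_elim
      case (elim m)
      have "- s * b * real m + ln (Z s m) - ln 2 = ln (exp (- s * b * real m) * Z s m / 2)"
        using Z_pos[OF s0, of m] by (simp add: ln_mult ln_div)
      also have "\<dots> \<le> ln (P (L t) m)"
        using elim Z_pos[OF s0, of m] by (intro ln_mono) auto
      finally have "(- s * b * real m + ln (Z s m) - ln 2) / real m \<le> ln (P (L t) m) / real m"
        by (rule divide_right_mono) simp
      moreover have "(- s * b * real m + ln (Z s m) - ln 2) / real m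
          = ln (Z s m) / real m - s * b - ln 2 / real m"
        using elim(3) by (simp add: add_divide_distrib diff_divide_distrib)
      ultimately show ?case using elim(1) by linarith
    qed
  qed
qed

section \<open>The limiting log moment generating function\<close>

text \<open>The logarithm of \<open>E exp (t (1/2 - U))\<close> for \<open>U\<close> uniform on \<open>[0,1]\<close>, for \<open>t > 0\<close>.\<close>

definition log_mgf :: "real \<Rightarrow> real" where
  "log_mgf t = t / 2 + ln ((1 - exp (- t)) / t)"

text \<open>The mean of \<open>1/2 - U\<close> under the law with density proportional to \<open>exp (- t u)\<close> on \<open>[0,1]\<close>, which is
  the derivative of \<open>log_mgf\<close>. In closed form it is \<open>coth (t / 2) / 2 - 1 / t\<close>.\<close>

definition tilted_mean :: "real \<Rightarrow> real" where
  "tilted_mean t = 1 / (1 - exp (- t)) - 1 / t - 1 / 2"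

lemma log_mgf_deriv:
  assumes "0 < t"
  shows "(log_mgf has_real_derivative tilted_mean t) (at t)"
proof -
  have "(log_mgf has_real_derivative
      1 / 2 + (exp (- t) * t - (1 - exp (- t))) / (t * t) / ((1 - exp (- t)) / t)) (at t)"
    unfolding log_mgf_def using assms by (auto intro!: derivative_eq_intros)
  moreover have "1 / 2 + (exp (- t) * t - (1 - exp (- t))) / (t * t) / ((1 - exp (- t)) / t) = tilted_mean t"
  proof -
    define z where "z = exp (- t)"
    have "z < 1" using assms by (simp add: z_def)
    then show ?thesis
      unfolding tilted_mean_def z_def[symmetric] using assms by (simp add: field_simps)
  qed
  ultimately show ?thesis by simp
qed

lemma less_exp_diff:
  fixes x :: real
  assumes "0 < x"
  shows "2 * x < exp x - exp (- x)"
proof -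
  have "exp 0 - exp (- 0) - 2 * 0 < exp x - exp (- x) - 2 * x"
  proof (rule DERIV_pos_imp_increasing_open[OF assms])
    fix y :: real assume y: "0 < y"
    have "((\<lambda>x. exp x - exp (- x) - 2 * x) has_real_derivative exp y + exp (- y) - 2) (at y)"
      by (auto intro!: derivative_eq_intros)
    moreover have "1 - y < exp (- y)" "1 + y \<le> exp y"
      using y by (simp_all add: exp_minus_greater)
    then have "0 < exp y + exp (- y) - 2" by linarith
    ultimately show "\<exists>z. ((\<lambda>x. exp x - exp (- x) - 2 * x) has_real_derivative z) (at y) \<and> 0 < z"
      by blast
  qed (intro continuous_intros)
  then show ?thesis by simp
qed

text \<open>Positivity of the derivative is the inequality \<open>t < 2 sinh (t / 2)\<close>, multiplied by
  \<open>exp (- t / 2)\<close> and squared.\<close>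

lemma tilted_mean_deriv:
  assumes "0 < t"
  shows "(tilted_mean has_real_derivative 1 / t\<^sup>2 - exp (- t) / (1 - exp (- t))\<^sup>2) (at t)"
    and "0 < 1 / t\<^sup>2 - exp (- t) / (1 - exp (- t))\<^sup>2"
proof -
  show "(tilted_mean has_real_derivative 1 / t\<^sup>2 - exp (- t) / (1 - exp (- t))\<^sup>2) (at t)"
    unfolding tilted_mean_def using assms
    by (auto intro!: derivative_eq_intros simp: power2_eq_square)
  have "exp (- t / 2) * t < exp (- t / 2) * (exp (t / 2) - exp (- t / 2))"
    using less_exp_diff[of "t / 2"] assms by simp
  also have "\<dots> = 1 - exp (- t)"
    by (simp add: right_diff_distrib flip: exp_add)
  finally have "(exp (- t / 2) * t)\<^sup>2 < (1 - exp (- t))\<^sup>2"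
    using assms by (intro power_strict_mono) auto
  moreover have "(exp (- t / 2))\<^sup>2 = exp (- t)"
    by (simp add: power2_eq_square flip: exp_add)
  ultimately have "exp (- t) * t\<^sup>2 < (1 - exp (- t))\<^sup>2"
    by (simp add: power_mult_distrib)
  then show "0 < 1 / t\<^sup>2 - exp (- t) / (1 - exp (- t))\<^sup>2"
    using assms by (simp add: field_simps)
qed

lemma strict_mono_tilted_mean: "strict_mono_on {0<..} tilted_mean"
proof (rule strict_mono_onI)
  fix r s :: real assume "r \<in> {0<..}" "s \<in> {0<..}" "r < s"
  then have "\<exists>y. (tilted_mean has_real_derivative y) (at x) \<and> 0 < y" if "r \<le> x" for x
    using that tilted_mean_deriv[of x] by (metis greaterThan_iff less_le_trans)
  then show "tilted_mean r < tilted_mean s"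
    by (intro DERIV_pos_imp_increasing[OF \<open>r < s\<close>])
qed

lemma tilted_mean_at_right_0: "(tilted_mean \<longlongrightarrow> 0) (at_right 0)"
  unfolding tilted_mean_def by real_asymp

lemma tilted_mean_pos:
  assumes "0 < t"
  shows "0 < tilted_mean t"
proof -
  have "0 \<le> tilted_mean (t / 2)"
  proof (rule tendsto_upperbound)
    show "(tilted_mean \<longlongrightarrow> 0) (at_right 0)"
      by (rule tilted_mean_at_right_0)
    have "\<forall>\<^sub>F s in at_right 0. s \<in> {0<..<t / 2}"
      using assms by (intro eventually_at_right_real) auto
    then show "\<forall>\<^sub>F s in at_right 0. tilted_mean s \<le> tilted_mean (t / 2)"
      by eventually_elim (auto intro!: less_imp_le strict_mono_onD[OF strict_mono_tilted_mean])
  qed simp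
  also have "\<dots> < tilted_mean t"
    using assms by (intro strict_mono_onD[OF strict_mono_tilted_mean]) auto
  finally show ?thesis .
qed

lemma tilted_mean_surj:
  assumes "0 < \<delta>" "\<delta> < 1 / 2"
  obtains t where "0 < t" "tilted_mean t = \<delta>"
proof -
  have "\<forall>\<^sub>F t in at_right 0. tilted_mean t < \<delta>"
    using tilted_mean_at_right_0 assms by (simp add: order_tendsto_iff)
  then obtain a where a: "0 < a" "tilted_mean a < \<delta>"
    by (auto simp: eventually_at_right_field dest: dense)
  have "(tilted_mean \<longlongrightarrow> 1 / 2) at_top"
    unfolding tilted_mean_def by real_asymp
  then have "\<forall>\<^sub>F t in at_top. \<delta> < tilted_mean t"
    using assms by (simp add: order_tendsto_iff)
  then have "\<forall>\<^sub>F t in at_top. \<delta> < tilted_mean t \<and> a < t"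
    using eventually_gt_at_top by (intro eventually_conj)
  then obtain b where b: "a < b" "\<delta> < tilted_mean b"
    by (auto simp: eventually_at_top_linorder)
  have "isCont tilted_mean x" if "a \<le> x" for x
    using tilted_mean_deriv(1)[of x] a that by (intro DERIV_isCont) auto
  then obtain t where "a \<le> t" "tilted_mean t = \<delta>"
    using IVT[of tilted_mean a \<delta> b] a b by auto
  then show ?thesis using a by (intro that[of t]) auto
qed

text \<open>Away from \<open>0\<close>, dividing the equation for \<open>\<lambda>\<close> by \<open>\<lambda> (1 - exp \<lambda>)\<close> and substituting \<open>\<lambda> = -t\<close> gives
  \<open>tilted_mean t = \<delta>\<close>.\<close>

lemma lam_equation_iff:
  assumes "0 < t"
  shows "(- t * (\<delta> + 1 / 2) - 1) * (1 - exp (- t)) = - t \<longleftrightarrow> tilted_mean t = \<delta>"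
proof -
  define z where "z = exp (- t)"
  have "z < 1" using assms by (simp add: z_def)
  then show ?thesis
    unfolding tilted_mean_def z_def[symmetric] using assms
    by (simp add: field_simps)
qed

text \<open>Strict monotonicity of \<open>tilted_mean\<close> makes \<open>-t\<close> the only negative solution, hence the least one.\<close>

lemma lam_eq:
  assumes "0 < t" "tilted_mean t = \<delta>"
  shows "lam \<delta> = - t"
  unfolding lam_def
proof (rule Least_equality)
  show "(- t * (\<delta> + 1 / 2) - 1) * (1 - exp (- t)) = - t"
    using lam_equation_iff[OF assms(1)] assms(2) by simp
next
  fix l :: real assume l: "(l * (\<delta> + 1 / 2) - 1) * (1 - exp l) = l"
  show "- t \<le> l"
  proof (cases "l < 0")
    case True
    then have "tilted_mean (- l) = \<delta>"
      using lam_equation_iff[of "- l" \<delta>] l by simp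
    then have "- l = t"
      using strict_mono_on_imp_inj_on[OF strict_mono_tilted_mean] assms True
      by (auto dest: inj_onD)
    then show ?thesis by simp
  qed (use assms in auto)
qed

text \<open>The logarithm in \<open>log_mgf t\<close> is expressed by \<open>\<delta>\<close> through the equation that \<open>-t\<close> solves.\<close>

lemma J_eq:
  assumes t: "0 < t" "tilted_mean t = \<delta>" and \<delta>: "\<delta> < 1 / 2"
  shows "J \<delta> = ereal (- (log_mgf t - t * \<delta>))"
proof -
  have z: "0 < 1 - exp (- t)" using t by simp
  have "t = (1 + (1 / 2 + \<delta>) * t) * (1 - exp (- t))"
    using lam_equation_iff[OF t(1), of \<delta>] t(2) by (simp add: algebra_simps)
  then have "1 + (1 / 2 + \<delta>) * t = t / (1 - exp (- t))"
    using z by (simp add: field_simps)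
  moreover have "ln (t / (1 - exp (- t))) = - ln ((1 - exp (- t)) / t)"
    using z t by (simp add: ln_div)
  ultimately show ?thesis
    using \<delta> by (simp add: J_def lam_eq[OF t] log_mgf_def algebra_simps)
qed

text \<open>A negative solution would give a positive \<open>t\<close> with \<open>tilted_mean t = 0\<close>.\<close>

lemma lam_0: "lam 0 = 0"
  unfolding lam_def
proof (rule Least_equality)
  fix l :: real assume l: "(l * (0 + 1 / 2) - 1) * (1 - exp l) = l"
  show "0 \<le> l"
  proof (rule ccontr)
    assume "\<not> 0 \<le> l"
    then show False
      using lam_equation_iff[of "- l" 0] tilted_mean_pos[of "- l"] l by simp
  qed
qed simp

section \<open>The moment generating function of the deficit\<close>

lemma expectation_replicate_pmf_prod:
  fixes f :: "'a \<Rightarrow> real"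
  assumes "finite (set_pmf p)"
  shows "measure_pmf.expectation (replicate_pmf n p) (\<lambda>xs. \<Prod>x\<leftarrow>xs. f x)
    = measure_pmf.expectation p f ^ n"
proof (induction n)
  case (Suc n)
  have fin: "finite (set_pmf (replicate_pmf n p))"
    using finite_lists_length_eq[OF assms, of n] by (simp add: set_replicate_pmf lists_eq_set)
  have "measure_pmf.expectation (replicate_pmf (Suc n) p) (\<lambda>xs. \<Prod>x\<leftarrow>xs. f x)
    = (\<Sum>a\<in>set_pmf p. pmf p a * measure_pmf.expectation
        (map_pmf (Cons a) (replicate_pmf n p)) (\<lambda>xs. \<Prod>x\<leftarrow>xs. f x))"
    using assms fin by (simp add: pmf_expectation_bind[OF assms] flip: map_pmf_def)
  also have "\<dots> = (\<Sum>a\<in>set_pmf p. pmf p a * f a) * measure_pmf.expectation p f ^ n"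
    by (simp add: Suc sum_distrib_right mult.assoc)
  also have "(\<Sum>a\<in>set_pmf p. pmf p a * f a) = measure_pmf.expectation p f"
    using assms by (subst integral_measure_pmf[of "set_pmf p"]) auto
  finally show ?case by simp
qed simp

lemma deficit_alt: "deficit m ks = real m * (real m - 1) / 2 - real (sum_list ks)"
proof -
  have "real (\<Sum>{..<m}) = real m * (real m - 1) / 2"
    by (induction m) (simp_all add: field_simps)
  then show ?thesis by (simp add: deficit_def)
qed

text \<open>Independence turns the expectation into an \<open>m\<close>-th power, whose base is a geometric sum.\<close>

lemma mgf_deficit:
  assumes "0 < m" "0 < t"
  shows "measure_pmf.expectation (replicate_pmf m (pmf_of_set {..<m}))
      (\<lambda>ks. exp (t * (deficit m ks / real m)))
    = exp (t * (real m - 1) / 2) * ((1 - exp (- t)) / (real m * (1 - exp (- t / real m)))) ^ m"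
proof -
  define q where "q = exp (- t / real m)"
  have q: "q < 1" using assms by (simp add: q_def)
  have prod: "(\<Prod>k\<leftarrow>ks. q ^ k) = q ^ sum_list ks" for ks
    by (induction ks) (simp_all add: power_add)
  have "exp (t * (deficit m ks / real m)) = exp (t * (real m - 1) / 2) * (\<Prod>k\<leftarrow>ks. q ^ k)" for ks
    unfolding prod unfolding q_def deficit_alt using assms
    by (simp add: field_simps flip: exp_add exp_of_nat_mult)
  moreover have "measure_pmf.expectation (pmf_of_set {..<m}) (\<lambda>k. q ^ k)
      = (1 - exp (- t)) / (real m * (1 - exp (- t / real m)))"
  proof -
    have "measure_pmf.expectation (pmf_of_set {..<m}) (\<lambda>k. q ^ k) = (\<Sum>k<m. q ^ k) / real m"
      using assms by (subst integral_pmf_of_set) auto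
    also have "(\<Sum>k<m. q ^ k) = (1 - q ^ m) / (1 - q)"
      using q by (simp add: sum_gp_strict)
    also have "q ^ m = exp (- t)"
      using assms by (simp add: q_def flip: exp_of_nat_mult)
    finally show ?thesis by (simp add: q_def mult.commute)
  qed
  moreover have "finite (set_pmf (pmf_of_set {..<m}))"
    using assms by (subst set_pmf_of_set) auto
  ultimately show ?thesis
    by (simp add: expectation_replicate_pmf_prod)
qed

lemma mgf_deficit_rate:
  assumes t: "0 < t"
  shows "(\<lambda>m. ln (measure_pmf.expectation (replicate_pmf m (pmf_of_set {..<m}))
      (\<lambda>ks. exp (t * (deficit m ks / real m)))) / real m) \<longlonglongrightarrow> log_mgf t"
proof (rule Lim_transform_eventually)
  show "(\<lambda>m. t * (real m - 1) / (2 * real m)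
      + ln ((1 - exp (- t)) / (real m * (1 - exp (- t / real m))))) \<longlonglongrightarrow> log_mgf t"
    unfolding log_mgf_def divide_inverse[of _ t] using t by real_asymp
  show "\<forall>\<^sub>F m in sequentially. t * (real m - 1) / (2 * real m)
      + ln ((1 - exp (- t)) / (real m * (1 - exp (- t / real m))))
    = ln (measure_pmf.expectation (replicate_pmf m (pmf_of_set {..<m}))
      (\<lambda>ks. exp (t * (deficit m ks / real m)))) / real m"
    using eventually_gt_at_top[of 0]
  proof eventually_elim
    case (elim m)
    have "0 < (1 - exp (- t)) / (real m * (1 - exp (- t / real m)))"
      using elim t by simp
    then show ?case
      unfolding mgf_deficit[OF elim t] using elim
      by (simp add: ln_mult ln_realpow add_divide_distrib)
  qed
qed

section \<open>The rate function of the total displacement\<close>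

theorem theorem3:
  fixes \<delta> :: real
  assumes "\<delta> \<ge> 0"
  shows "(\<lambda>m::nat. - (ereal (1 / real m) *
            elog (measure_pmf.prob (total_displacement_pmf m m) {d. real d \<ge> (real m)\<^sup>2 * \<delta>})))
         \<longlonglongrightarrow> J \<delta>"
proof -
  define T where "T m = measure_pmf.prob (replicate_pmf m (pmf_of_set {..<m}))
    {ks. (real m)\<^sup>2 * \<delta> \<le> deficit m ks}" for m
  define D where "D m = measure_pmf.prob (total_displacement_pmf m m)
    {d. (real m)\<^sup>2 * \<delta> \<le> real d}" for m
  have sandwich: "T m \<le> D m" "D m \<le> real m * T m" if "0 < m" for m
    unfolding T_def D_def using that
    by (intro prob_total_displacement_sandwich; simp)+
  consider "\<delta> = 0" | "0 < \<delta>" "\<delta> < 1 / 2" | "1 / 2 \<le> \<delta>" using assms by linarith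
  then have "(\<lambda>m. - (ereal (1 / real m) * elog (D m))) \<longlonglongrightarrow> J \<delta>"
  proof cases
    case 1
    then have "D m = 1" for m by (simp add: D_def)
    then show ?thesis using 1 by (simp add: J_def lam_0 elog_def)
  next
    case 2
    obtain t where t: "0 < t" "tilted_mean t = \<delta>" using 2 by (rule tilted_mean_surj)
    have "{ks. \<delta> * real m \<le> deficit m ks / real m} = {ks. (real m)\<^sup>2 * \<delta> \<le> deficit m ks}"
      if "0 < m" for m
      using that by (simp add: field_simps power2_eq_square)
    then have T: "measure_pmf.prob (replicate_pmf m (pmf_of_set {..<m}))
        {ks. \<delta> * real m \<le> deficit m ks / real m} = T m" if "0 < m" for m
      using that by (simp add: T_def)
    have fin: "finite (set_pmf (replicate_pmf m (pmf_of_set {..<m})))" for m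
    proof (cases "m = 0")
      case False
      then show ?thesis
        using finite_lists_length_eq[of "{..<m}" m]
        by (simp add: set_replicate_pmf lists_eq_set lessThan_empty_iff)
    qed simp
    have cont: "isCont tilted_mean t" using tilted_mean_deriv(1)[OF t(1)] by (rule DERIV_isCont)
    note tail = upper_tail_rate[where p = "\<lambda>m. replicate_pmf m (pmf_of_set {..<m})"
        and Y = "\<lambda>m ks. deficit m ks / real m",
        OF integrable_measure_pmf_finite[OF fin] mgf_deficit_rate
          log_mgf_deriv strict_mono_tilted_mean cont t(1), unfolded t(2)]
    have rate: "\<forall>\<^sub>F m in sequentially. 0 < measure_pmf.prob (replicate_pmf m (pmf_of_set {..<m}))
        {ks. \<delta> * real m \<le> deficit m ks / real m}"
      "(\<lambda>m. ln (measure_pmf.prob (replicate_pmf m (pmf_of_set {..<m}))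
        {ks. \<delta> * real m \<le> deficit m ks / real m}) / real m) \<longlonglongrightarrow> log_mgf t - t * \<delta>"
      by (rule tail; assumption)+
    have T_pos: "\<forall>\<^sub>F m in sequentially. 0 < T m"
      using rate(1) eventually_gt_at_top[of 0] by eventually_elim (simp add: T)
    have "\<forall>\<^sub>F m in sequentially. ln (measure_pmf.prob (replicate_pmf m (pmf_of_set {..<m}))
        {ks. \<delta> * real m \<le> deficit m ks / real m}) / real m = ln (T m) / real m"
      using eventually_gt_at_top[of 0] by eventually_elim (simp add: T)
    from Lim_transform_eventually[OF rate(2) this]
    have lim: "(\<lambda>m. ln (T m) / real m) \<longlonglongrightarrow> log_mgf t - t * \<delta>" .
    moreover have "(\<lambda>m. ln (real m) / real m) \<longlonglongrightarrow> 0" by real_asymp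
    ultimately have lim': "(\<lambda>m. ln (real m) / real m + ln (T m) / real m) \<longlonglongrightarrow> log_mgf t - t * \<delta>"
      using tendsto_add by fastforce
    have "\<forall>\<^sub>F m in sequentially. ln (T m) / real m \<le> ln (D m) / real m"
      using T_pos eventually_gt_at_top[of 0]
      by eventually_elim (use sandwich in \<open>auto intro!: divide_right_mono ln_mono\<close>)
    moreover have "\<forall>\<^sub>F m in sequentially. ln (D m) / real m \<le> ln (real m) / real m + ln (T m) / real m"
      using T_pos eventually_gt_at_top[of 0]
    proof eventually_elim
      case (elim m)
      have "ln (D m) \<le> ln (real m * T m)"
        using elim sandwich[of m] by (intro ln_mono) auto
      also have "\<dots> = ln (real m) + ln (T m)" using elim by (simp add: ln_mult)
      finally show ?case using elim by (simp add: divide_right_mono flip: add_divide_distrib)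
    qed
    ultimately have "(\<lambda>m. ln (D m) / real m) \<longlonglongrightarrow> log_mgf t - t * \<delta>"
      using lim lim' by (rule tendsto_sandwich)
    then have "(\<lambda>m. ereal (- (ln (D m) / real m))) \<longlonglongrightarrow> J \<delta>"
      unfolding J_eq[OF t 2(2)] by (intro tendsto_ereal tendsto_minus)
    moreover have "\<forall>\<^sub>F m in sequentially. ereal (- (ln (D m) / real m)) = - (ereal (1 / real m) * elog (D m))"
      using T_pos eventually_gt_at_top[of 0]
    proof eventually_elim
      case (elim m)
      then have "0 < D m" using sandwich(1)[of m] by linarith
      then show ?case by (simp add: elog_def)
    qed
    ultimately show ?thesis by (rule Lim_transform_eventually)
  next
    case 3
    \<comment> \<open>the deficit is largest when all cars have coordinate \<open>0\<close>, and even then it stays below \<open>m\<^sup>2 / 2\<close>\<close>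
    have "D m = 0" if m: "0 < m" for m
    proof -
      have "deficit m ks < (real m)\<^sup>2 * \<delta>" for ks
      proof -
        have "deficit m ks \<le> real m * (real m - 1) / 2"
          by (simp add: deficit_alt)
        also have "\<dots> < (real m)\<^sup>2 * (1 / 2)"
          using m by (simp add: power2_eq_square)
        also have "\<dots> \<le> (real m)\<^sup>2 * \<delta>"
          using 3 by (intro mult_left_mono) auto
        finally show ?thesis .
      qed
      then have "{ks. (real m)\<^sup>2 * \<delta> \<le> deficit m ks} = {}"
        by (auto simp: not_le)
      then have "T m = 0" by (simp add: T_def)
      then show ?thesis using sandwich[OF m] by simp
    qed
    then have "\<forall>\<^sub>F m in sequentially. \<infinity> = - (ereal (1 / real m) * elog (D m))"
      using eventually_gt_at_top[of 0] by (auto elim!: eventually_mono simp: elog_def)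
    then have "(\<lambda>m. - (ereal (1 / real m) * elog (D m))) \<longlonglongrightarrow> \<infinity>"
      by (intro Lim_transform_eventually[OF tendsto_const])
    then show ?thesis using 3 by (simp add: J_def)
  qed
  then show ?thesis by (simp add: D_def)
qed

end
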